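(* Let $q\in C[-b,b]$ be complex valued, let $f$ be a solution of $f''=qf$ on $[-b,b]$ with $f\neq0$ on $[-b,b]$, $f(0)=1$, and $h:=f'(0)$. Suppose that the functions $\frac h2+\frac14\int_0^xq(s)\,ds$ and $\frac14\int_0^xq(s)\,ds$ admit the series expansions $$\frac h2+\frac14\int_0^xq(s)\,ds=\sum_{n=0}^\infty a_n\mathbf{c}_n(x)\qquad\text{and}\qquad \frac14\int_0^xq(s)\,ds=\sum_{n=1}^\infty b_n\mathbf{s}_n(x),$$ uniformly convergent on $[-b,b]$, with complex coefficients $a_n$, $b_n$. Then $$a_{2n}=b_{2n}\qquad\text{for any } n\in\mathbb{N}.$$
   Context: $\mathbb{N}=\{1,2,\ldots\}$. Functions $\varphi_k$ on $[-b,b]$: $X^{(0)}\equiv\widetilde X^{(0)}\equiv1$, $X^{(n)}(x)=n\int_0^x X^{(n-1)}(s)\left(f^2(s)\right)^{(-1)^n}ds$, $\widetilde X^{(n)}(x)=n\int_0^x \widetilde X^{(n-1)}(s)\left(f^2(s)\right)^{(-1)^{n-1}}ds$ for $n\ge1$; $\varphi_k=fX^{(k)}$ for $k$ odd, $\varphi_k=f\widetilde X^{(k)}$ for $k$ even. Then $\mathbf{c}_0=f$, $\mathbf{s}_0\equiv0$, and for $m\ge1$, $\mathbf{c}_m(x)=\sum_{\text{even }k=0}^m\binom mk x^k\varphi_{m-k}(x)$, $\mathbf{s}_m(x)=\sum_{\text{odd }k=1}^m\binom mk x^k\varphi_{m-k}(x)$. *)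

theory Defs
  imports "HOL-Analysis.Analysis"
begin

text \<open>
  The integrals from \<open>0\<close> to \<open>x\<close> are oriented, so \<open>x\<close> may be negative:
  \<open>LBINT s=0..x. g s\<close> is minus the integral over the interval from \<open>x\<close> to \<open>0\<close> in that case.
  The exponents \<open>(-1)^n\<close> are integers, hence the use of \<open>powi\<close>.
\<close>

primrec recX :: "(real \<Rightarrow> complex) \<Rightarrow> nat \<Rightarrow> real \<Rightarrow> complex" where
  "recX f 0 = (\<lambda>x. 1)"
| "recX f (Suc n) = (\<lambda>x. of_nat (Suc n) *
     (LBINT s=0..x. recX f n s * (f s ^ 2) powi ((-1) ^ Suc n)))"

text \<open>Here \<open>Suc n\<close> is the index, so the exponent of \<open>-1\<close> (the index minus one) is \<open>n\<close>.\<close>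

primrec recXt :: "(real \<Rightarrow> complex) \<Rightarrow> nat \<Rightarrow> real \<Rightarrow> complex" where
  "recXt f 0 = (\<lambda>x. 1)"
| "recXt f (Suc n) = (\<lambda>x. of_nat (Suc n) *
     (LBINT s=0..x. recXt f n s * (f s ^ 2) powi ((-1) ^ n)))"

definition phi :: "(real \<Rightarrow> complex) \<Rightarrow> nat \<Rightarrow> real \<Rightarrow> complex" where
  "phi f k x = (if odd k then f x * recX f k x else f x * recXt f k x)"

text \<open>
  The separate conventions for the index \<open>0\<close> are instances of the general formulas;
  see \<open>cfun_0\<close> and \<open>sfun_0\<close>.
\<close>

definition cfun :: "(real \<Rightarrow> complex) \<Rightarrow> nat \<Rightarrow> real \<Rightarrow> complex" where
  "cfun f m x = (\<Sum>k | k \<le> m \<and> even k. of_nat (m choose k) * of_real x ^ k * phi f (m - k) x)"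

definition sfun :: "(real \<Rightarrow> complex) \<Rightarrow> nat \<Rightarrow> real \<Rightarrow> complex" where
  "sfun f m x = (\<Sum>k | k \<le> m \<and> odd k. of_nat (m choose k) * of_real x ^ k * phi f (m - k) x)"

lemma cfun_0: "cfun f 0 = f"
proof -
  have "{k::nat. k \<le> 0 \<and> even k} = {0}" by auto
  then show ?thesis by (simp add: fun_eq_iff cfun_def phi_def)
qed

lemma sfun_0: "sfun f 0 = (\<lambda>x. 0)"
proof -
  have "{k::nat. k \<le> 0 \<and> odd k} = {}" by (auto elim: oddE)
  then show ?thesis by (simp only: fun_eq_iff sfun_def sum.empty) simp
qed

end

theory Submission
  imports Defs "HOL-Complex_Analysis.Cauchy_Integral_Formula"
begin

text \<open>
  Let \<open>u\<^sub>N(x,t)\<close> be the sum over \<open>n \<le> N\<close> and \<open>j \<le> n\<close> of \<open>(n choose j) \<phi>\<^sub>n\<^sub>-\<^sub>j(x) t^j\<close>, weighted by \<open>\<alpha>\<^sub>n\<close> for even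
  \<open>j\<close> and by \<open>\<beta>\<^sub>n\<close> for odd \<open>j\<close>. It solves the wave equation \<open>u\<^sub>x\<^sub>x - q u = u\<^sub>t\<^sub>t\<close>, because
  \<open>\<phi>\<^sub>k'' = q \<phi>\<^sub>k + k(k - 1) \<phi>\<^sub>k\<^sub>-\<^sub>2\<close>. On the characteristics \<open>t = x\<close> and \<open>t = -x\<close> it equals the sum and the
  difference of the two given partial sums, so its Goursat data converge uniformly, to
  \<open>h/2 + (1/2) \<integral>\<^sub>0\<^sup>x q\<close> and to \<open>h/2\<close>. These are the data of the kernel \<open>K\<close> of the transmutation operator
  that sends \<open>x^k\<close> to \<open>\<phi>\<^sub>k\<close>.

  Replace every \<open>\<phi>\<^sub>k(x)\<close> in \<open>u\<^sub>N\<close> by \<open>x^k\<close> and call the result \<open>v\<^sub>N\<close>. The constant term of the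
  polynomial \<open>v\<^sub>N(x,-x)\<close> is \<open>\<alpha>\<^sub>0\<close>, and its coefficient at \<open>x^n\<close> is \<open>(\<alpha>\<^sub>n - \<beta>\<^sub>n) 2^(n-1)\<close> for
  \<open>n \<ge> 1\<close>. Hence the theorem follows once \<open>v\<^sub>N(x,-x) + v\<^sub>N(-x,x)\<close> is known to converge to a constant
  for every \<open>x\<close>: a power series with constant sum has no terms of positive degree.

  The reason for this convergence is that the inverse transmutation has a kernel built from the
  same \<open>K\<close> with exchanged arguments, namely \<open>x^k = \<phi>\<^sub>k(x) - \<integral> K(s,x) \<phi>\<^sub>k(s) ds\<close>, integrated over \<open>s\<close>
  from \<open>-x\<close> to \<open>x\<close>. Linear combination gives \<open>v(x,t) = K(x,t) - \<integral> K(s,x) K(s,t) ds\<close>. For \<open>t = -x\<close> the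
  integrand is invariant under \<open>x \<mapsto> -x\<close> while the limits of integration are exchanged, so the
  integral is odd in \<open>x\<close> and cancels: \<open>v(x,-x) + v(-x,x) = K(x,-x) + K(-x,x) = h\<close>.

  The proof runs this argument with \<open>u\<^sub>N\<close> in the place of \<open>K\<close>. Two facts carry it. The first,
  \<open>moment_limit\<close>, is the formula for the inverse in the limit: the integrals of \<open>u\<^sub>N(s,x) \<phi>\<^sub>k(s)\<close>
  satisfy differential equations in \<open>x\<close> that involve \<open>u\<^sub>N\<close> only through its Goursat data, so they
  converge to \<open>\<phi>\<^sub>k(x) - x^k\<close>. The second, \<open>goursat_bound\<close>, says that a wave is controlled in the region
  \<open>\<bar>x\<bar> \<le> \<bar>t\<bar> \<le> b\<close> by its Goursat data; it makes \<open>u\<^sub>N\<close> bounded and uniformly Cauchy there, and so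
  allows both factors of \<open>K(s,x) K(s,-x)\<close> to be replaced by the same partial sum.
\<close>

section \<open>Binomial double sums and their second differences\<close>

text \<open>
  Keeping the functions of \<open>x\<close> and of \<open>t\<close> as arbitrary sequences \<open>P\<close> and \<open>T\<close> lets one bilinear expression
  stand for a wave, for its partial derivatives, for its integrals against a fixed function and for
  its counterpart with \<open>q = 0\<close>.
\<close>

definition wsum :: "(nat \<Rightarrow> complex) \<Rightarrow> (nat \<Rightarrow> complex) \<Rightarrow> nat set \<Rightarrow> (nat \<Rightarrow> complex) \<Rightarrow> (nat \<Rightarrow> complex) \<Rightarrow> complex"
  where "wsum \<alpha> \<beta> A P T =
    (\<Sum>n\<in>A. \<Sum>j\<le>n. of_nat (n choose j) * (if even j then \<alpha> n else \<beta> n) * P (n - j) * T j)"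

text \<open>
  This is the wave equation on the level of coefficients: two differentiations in \<open>x\<close> take \<open>P\<^sub>i\<close> to
  \<open>i(i - 1) P\<^sub>i\<^sub>-\<^sub>2\<close>, two in \<open>t\<close> take \<open>T\<^sub>j\<close> to \<open>j(j - 1) T\<^sub>j\<^sub>-\<^sub>2\<close>. The sums agree after the shift \<open>j \<mapsto> j + 2\<close>, which
  preserves the parity of \<open>j\<close> and hence the choice between \<open>\<alpha>\<close> and \<open>\<beta>\<close>.
\<close>

lemma wsum_shift:
  "wsum \<alpha> \<beta> A (\<lambda>i. of_nat i * of_nat (i - 1) * P (i - 2)) T
   = wsum \<alpha> \<beta> A P (\<lambda>j. of_nat j * of_nat (j - 1) * T (j - 2))"
  unfolding wsum_def
proof (rule sum.cong[OF refl])
  fix n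
  let ?L = "\<lambda>j. of_nat (n choose j) * (if even j then \<alpha> n else \<beta> n)
      * (of_nat (n - j) * of_nat (n - j - 1) * P (n - j - 2)) * T j"
  let ?R = "\<lambda>j. of_nat (n choose j) * (if even j then \<alpha> n else \<beta> n)
      * P (n - j) * (of_nat j * of_nat (j - 1) * T (j - 2))"
  show "sum ?L {..n} = sum ?R {..n}"
  proof (cases "n < 2")
    case True
    then have "n = 0 \<or> n = 1" by auto
    then show ?thesis by auto
  next
    case False
    then obtain m where m: "n = m + 2"
      by (metis add.commute le_Suc_ex not_less)
    have "sum ?L {..n} = sum ?L {..m}"
      by (rule sum.mono_neutral_right) (auto simp: m)
    also have "\<dots> = (\<Sum>j\<le>m. ?R (j + 2))"
    proof (rule sum.cong)
      fix j assume "j \<in> {..m}"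
      then have j: "j \<le> m" by simp
      have 1: "Suc k * (n choose Suc k) = (n - k) * (n choose k)" for k
        using binomial_absorption[of k n] binomial_absorb_comp[of n k] by simp
      have "(j + 2) * ((j + 1) * (n choose (j + 2))) = (j + 1) * (Suc (j + 1) * (n choose Suc (j + 1)))"
        by (simp only: Suc_eq_plus1 add.assoc one_add_one mult.left_commute)
      also have "\<dots> = (n - (j + 1)) * (Suc j * (n choose Suc j))"
        unfolding 1[of "j + 1"] by (simp only: Suc_eq_plus1 mult.left_commute)
      also have "\<dots> = (n - (j + 1)) * ((n - j) * (n choose j))"
        by (simp only: 1)
      finally have "(of_nat ((j + 2) * ((j + 1) * (n choose (j + 2)))) :: complex)
          = of_nat ((n - (j + 1)) * ((n - j) * (n choose j)))" by presburger
      then have "of_nat (n choose j) * (of_nat (n - j) * of_nat (n - j - 1))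
          = (of_nat (n choose (j + 2)) * (of_nat (j + 2) * of_nat (j + 1)) :: complex)"
        unfolding of_nat_mult diff_diff_left by (simp only: mult_ac)
      then have "of_nat (n choose j) * (of_nat (n - j) * of_nat (n - j - 1))
            * ((if even j then \<alpha> n else \<beta> n) * P (n - j - 2) * T j)
          = of_nat (n choose (j + 2)) * (of_nat (j + 2) * of_nat (j + 1))
            * ((if even j then \<alpha> n else \<beta> n) * P (n - j - 2) * T j)" by simp
      then show "?L j = ?R (j + 2)" by (simp add: mult_ac del: of_nat_add of_nat_Suc)
    qed simp
    also have "\<dots> = sum ?R {0 + 2..m + 2}"
      by (subst sum.shift_bounds_cl_nat_ivl) (simp add: atMost_atLeast0)
    also have "\<dots> = sum ?R {..n}"
      by (rule sum.mono_neutral_left) (use less_2_cases in \<open>auto simp: m\<close>)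
    finally show ?thesis .
  qed
qed

lemma wsum_add: "wsum \<alpha> \<beta> A (\<lambda>i. P i + P' i) T = wsum \<alpha> \<beta> A P T + wsum \<alpha> \<beta> A P' T"
  by (simp add: wsum_def sum.distrib algebra_simps)

lemma wsum_diff: "wsum \<alpha> \<beta> A (\<lambda>i. P i - P' i) T = wsum \<alpha> \<beta> A P T - wsum \<alpha> \<beta> A P' T"
  by (simp add: wsum_def sum_subtractf algebra_simps)

lemma wsum_mult: "wsum \<alpha> \<beta> A (\<lambda>i. c * P i) T = c * wsum \<alpha> \<beta> A P T"
  by (simp add: wsum_def sum_distrib_left algebra_simps)

lemma wsum_mult_right: "wsum \<alpha> \<beta> A (\<lambda>i. P i * c) T = wsum \<alpha> \<beta> A P T * c"
  by (simp add: wsum_def sum_distrib_right sum_distrib_left algebra_simps)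

lemma wsum_minus: "wsum \<alpha> \<beta> A (\<lambda>i. - P i) T = - wsum \<alpha> \<beta> A P T"
  by (simp add: wsum_def sum_negf)

lemma wsum_has_vector_derivative:
  assumes "\<And>i. ((\<lambda>x. P x i) has_vector_derivative P' i) (at x within S)"
    and "\<And>j. ((\<lambda>x. T x j) has_vector_derivative T' j) (at x within S)"
  shows "((\<lambda>x. wsum \<alpha> \<beta> A (P x) (T x)) has_vector_derivative
           (wsum \<alpha> \<beta> A P' (T x) + wsum \<alpha> \<beta> A (P x) T')) (at x within S)"
proof -
  have "((\<lambda>x. wsum \<alpha> \<beta> A (P x) (T x)) has_vector_derivative
      (\<Sum>n\<in>A. \<Sum>j\<le>n. of_nat (n choose j) * (if even j then \<alpha> n else \<beta> n)
         * (P x (n - j) * T' j + P' (n - j) * T x j))) (at x within S)"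
    unfolding wsum_def mult.assoc
    by (intro has_vector_derivative_sum has_vector_derivative_mult_right
        has_vector_derivative_mult assms)
  moreover have "(\<Sum>n\<in>A. \<Sum>j\<le>n. of_nat (n choose j) * (if even j then \<alpha> n else \<beta> n)
         * (P x (n - j) * T' j + P' (n - j) * T x j)) = wsum \<alpha> \<beta> A P' (T x) + wsum \<alpha> \<beta> A (P x) T'"
    by (simp add: wsum_def sum.distrib algebra_simps)
  ultimately show ?thesis by simp
qed

lemma continuous_on_wsum:
  assumes "\<And>i. continuous_on S (\<lambda>x. P x i)" "\<And>j. continuous_on S (\<lambda>x. T x j)"
  shows "continuous_on S (\<lambda>x. wsum \<alpha> \<beta> A (P x) (T x))"
  unfolding wsum_def by (intro continuous_intros assms)

lemma tendsto_wsum: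
  assumes "\<And>i. ((\<lambda>N. P N i) \<longlongrightarrow> P' i) F"
  shows "((\<lambda>N. wsum \<alpha> \<beta> A (P N) T) \<longlongrightarrow> wsum \<alpha> \<beta> A P' T) F"
  unfolding wsum_def by (intro tendsto_intros assms)

lemma power_has_vector_derivative_affine:
  "((\<lambda>x::real. complex_of_real (c * x + d) ^ j) has_vector_derivative
     of_real c * (of_nat j * complex_of_real (c * x + d) ^ (j - 1))) (at x within S)"
  unfolding has_vector_derivative_def
  apply (rule derivative_eq_intros refl | simp)+
  apply (simp add: fun_eq_iff scaleR_conv_of_real)
  done

lemma power_has_vector_derivative:
  "((\<lambda>x::real. complex_of_real x ^ j) has_vector_derivative of_nat j * of_real x ^ (j - 1)) (at x within S)"
  using power_has_vector_derivative_affine[of 1 0] by simp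

text \<open>
  The reflection \<open>t \<mapsto> -t\<close> changes the sign of the odd powers only, so it acts on the coefficients and
  what is proved for \<open>t \<ge> 0\<close> carries over to \<open>t \<le> 0\<close>.
\<close>

lemma wsum_minus_odd:
  "wsum \<alpha> \<beta> A P (\<lambda>j. (- t) ^ j) = wsum \<alpha> (\<lambda>n. - \<beta> n) A P (\<lambda>j. t ^ j)"
  unfolding wsum_def by (intro sum.cong refl) (auto simp: power_minus_odd)

lemma wsum_power_diag:
  "wsum \<alpha> \<beta> A (\<lambda>i. x ^ i) (\<lambda>j. (- x) ^ j)
   = (\<Sum>n\<in>A. (\<Sum>j\<le>n. of_nat (n choose j) * (if even j then \<alpha> n else \<beta> n) * (- 1) ^ j) * x ^ n)"
  unfolding wsum_def sum_distrib_right
proof (intro sum.cong refl)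
  fix n j :: nat assume "j \<in> {..n}"
  then have "x ^ (n - j) * (- x) ^ j = (- 1) ^ j * x ^ n"
    by (simp add: power_minus[of x j] flip: power_add)
  then show "of_nat (n choose j) * (if even j then \<alpha> n else \<beta> n) * x ^ (n - j) * (- x) ^ j =
         of_nat (n choose j) * (if even j then \<alpha> n else \<beta> n) * (- 1) ^ j * x ^ n"
    by (simp add: mult.assoc)
qed

lemma alternating_binomial_coeff:
  assumes "n \<ge> 1"
  shows "(\<Sum>j\<le>n. of_nat (n choose j) * (if even j then a else c) * (- 1) ^ j)
    = (a - c) * (2 ^ (n - 1) :: complex)"
    (is "?L = _")
proof -
  have "?L = a * (\<Sum>j\<le>n. if even j then of_nat (n choose j) else 0)
      - c * (\<Sum>j\<le>n. if odd j then of_nat (n choose j) else 0)"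
    unfolding sum_distrib_left sum_subtractf[symmetric] by (intro sum.cong) auto
  moreover have "2 * (\<Sum>j\<le>n. if even j then of_nat (n choose j) else 0) = (2 * 2 ^ (n - 1) :: complex)"
    using choose_even_sum[of n, where 'a = complex] assms by (cases n) auto
  moreover have "2 * (\<Sum>j\<le>n. if odd j then of_nat (n choose j) else 0) = (2 * 2 ^ (n - 1) :: complex)"
    using choose_odd_sum[of n, where 'a = complex] assms by (cases n) auto
  ultimately show ?thesis by (simp add: algebra_simps)
qed

section \<open>Integrals over symmetric intervals\<close>

text \<open>
  The integral of \<open>g\<close> from \<open>-x\<close> to \<open>x\<close>, oriented: as a difference of values of one primitive it is defined
  for \<open>\<bar>x\<bar> \<le> b\<close> with either sign of \<open>x\<close> and is visibly odd in \<open>x\<close>.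
\<close>

definition symint :: "real \<Rightarrow> (real \<Rightarrow> complex) \<Rightarrow> real \<Rightarrow> complex" where
  "symint b g x = integral {-b..x} g - integral {-b..-x} g"

lemma symint_minus: "symint b g (- x) = - symint b g x"
  by (simp add: symint_def)

lemma has_vector_derivative_reflect:
  assumes "(G has_vector_derivative D) (at (- x) within {-b..b})"
  shows "((\<lambda>x. G (- x)) has_vector_derivative - D) (at x within {-b..b::real})"
proof -
  have "((\<lambda>x::real. - x) has_vector_derivative - 1) (at x within {-b..b})"
    by (auto intro!: derivative_eq_intros)
  moreover have "(G has_vector_derivative D) (at (- x) within (\<lambda>x. - x) ` {-b..b})"
    using assms by simp
  ultimately show ?thesis
    using vector_diff_chain_within[of "\<lambda>x. - x" "-1" x "{-b..b}" G D]
    by (simp add: o_def)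
qed

lemma symint_has_vector_derivative:
  assumes "continuous_on {-b..b} g" "x \<in> {-b..b}"
  shows "(symint b g has_vector_derivative g x + g (- x)) (at x within {-b..b})"
proof -
  have 1: "((\<lambda>x. integral {-b..x} g) has_vector_derivative g y) (at y within {-b..b})"
    if "y \<in> {-b..b}" for y
    using integral_has_vector_derivative[OF assms(1) that] .
  have "((\<lambda>x. integral {-b..- x} g) has_vector_derivative - g (- x)) (at x within {-b..b})"
    using assms(2) by (intro has_vector_derivative_reflect[where G = "\<lambda>x. integral {-b..x} g"] 1) auto
  from has_vector_derivative_diff[OF 1[OF assms(2)] this] show ?thesis
    unfolding symint_def by simp
qed

lemma symint_eq:
  assumes "\<And>x. x \<in> {-b..b} \<Longrightarrow> (G has_vector_derivative g x) (at x within {-b..b})"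
    and "x \<in> {-b..b}"
  shows "symint b g x = G x - G (- x)"
proof -
  have "integral {-b..y} g = G y - G (- b)" if "y \<in> {-b..b}" for y
    using that by (intro integral_unique fundamental_theorem_of_calculus
        has_vector_derivative_within_subset[OF assms(1)]) auto
  from this[of x] this[of "-x"] show ?thesis using assms(2) by (simp add: symint_def)
qed

lemma symint_integrable:
  assumes "continuous_on {-b..b} g" "x \<in> {-b..b::real}"
  shows "(g::real \<Rightarrow> complex) integrable_on {-b..x}"
  using assms(2) by (intro integrable_continuous_real continuous_on_subset[OF assms(1)]) auto

lemma symint_add:
  assumes "continuous_on {-b..b} g" "continuous_on {-b..b} k" "x \<in> {-b..b}"
  shows "symint b (\<lambda>s. g s + k s) x = symint b g x + symint b k x"
  using assms symint_integrable[OF assms(1), of x] symint_integrable[OF assms(1), of "-x"]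
    symint_integrable[OF assms(2), of x] symint_integrable[OF assms(2), of "-x"]
  by (simp add: symint_def integral_add)

lemma symint_diff:
  assumes "continuous_on {-b..b} g" "continuous_on {-b..b} k" "x \<in> {-b..b}"
  shows "symint b (\<lambda>s. g s - k s) x = symint b g x - symint b k x"
  using assms symint_integrable[OF assms(1), of x] symint_integrable[OF assms(1), of "-x"]
    symint_integrable[OF assms(2), of x] symint_integrable[OF assms(2), of "-x"]
  by (simp add: symint_def integral_diff)

lemma symint_mult: "symint b (\<lambda>s. c * g s) x = c * symint b g x"
  by (simp add: symint_def algebra_simps)

lemma symint_sum:
  assumes "\<And>a. a \<in> A \<Longrightarrow> continuous_on {-b..b} (g a)" "x \<in> {-b..b}"
  shows "symint b (\<lambda>s. \<Sum>a\<in>A. g a s) x = (\<Sum>a\<in>A. symint b (g a) x)"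
proof (cases "finite A")
  case True
  then show ?thesis using assms(1)
  proof (induction A)
    case (insert a A)
    then have "continuous_on {-b..b} (g a)" "continuous_on {-b..b} (\<lambda>s. \<Sum>a\<in>A. g a s)"
      by (auto intro!: continuous_on_sum)
    with insert show ?case using assms(2) by (simp add: symint_add)
  qed (simp add: symint_def)
qed (simp add: symint_def)

lemma symint_wsum:
  assumes "\<And>i. continuous_on {-b..b} (\<lambda>s. P s i)" "continuous_on {-b..b} g" "x \<in> {-b..b}"
  shows "symint b (\<lambda>s. wsum \<alpha> \<beta> A (P s) T * g s) x
       = wsum \<alpha> \<beta> A (\<lambda>i. symint b (\<lambda>s. P s i * g s) x) T"
proof -
  have "symint b (\<lambda>s. wsum \<alpha> \<beta> A (P s) T * g s) x
      = symint b (\<lambda>s. \<Sum>n\<in>A. \<Sum>j\<le>n. (of_nat (n choose j) * (if even j then \<alpha> n else \<beta> n) * T j)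
            * (P s (n - j) * g s)) x"
    unfolding wsum_def sum_distrib_right by (intro arg_cong2[where f = "symint b"] sum.cong ext refl) (simp add: mult_ac)
  also have "\<dots> = (\<Sum>n\<in>A. \<Sum>j\<le>n. (of_nat (n choose j) * (if even j then \<alpha> n else \<beta> n) * T j)
            * symint b (\<lambda>s. P s (n - j) * g s) x)"
    by (subst symint_sum, intro continuous_intros assms, rule assms, rule sum.cong[OF refl],
        subst symint_sum, intro continuous_intros assms, rule assms, simp add: symint_mult)
  finally show ?thesis by (simp add: wsum_def mult_ac)
qed

text \<open>
  Only values of \<open>g\<close> on \<open>\<bar>s\<bar> \<le> \<bar>x\<bar>\<close> enter. This restriction matters because the Goursat data control
  a wave \<open>u(s,x)\<close> there.
\<close>

lemma norm_symint_le:
  assumes g: "continuous_on {-b..b} g" and x: "x \<in> {-b..b}"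
    and B: "\<And>s. \<bar>s\<bar> \<le> \<bar>x\<bar> \<Longrightarrow> norm (g s) \<le> B"
  shows "norm (symint b g x) \<le> 2 * b * B"
proof -
  have pos: "norm (symint b g y) \<le> 2 * b * B" if y: "y \<in> {0..b}" "\<bar>y\<bar> = \<bar>x\<bar>" for y
  proof -
    have gi: "g integrable_on {-b..y}" using symint_integrable[OF g, of y] y by auto
    have "integral {-b..-y} g + integral {-y..y} g = integral {-b..y} g"
      using y gi by (intro Henstock_Kurzweil_Integration.integral_combine) auto
    then have "symint b g y = integral {-y..y} g" by (simp add: symint_def algebra_simps)
    moreover have "norm (integral {-y..y} g) \<le> B * (y - (- y))"
      using y by (intro integral_bound continuous_on_subset[OF g] B) auto
    moreover have "B \<ge> 0" using B[of 0] norm_ge_zero[of "g 0"] by linarith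
    then have "B * (y - (- y)) \<le> B * (2 * b)" using y by (intro mult_left_mono) auto
    ultimately show ?thesis by (simp add: mult_ac)
  qed
  show ?thesis
  proof (cases "x \<ge> 0")
    case True then show ?thesis using pos[of x] x by auto
  next
    case False then show ?thesis using pos[of "-x"] x by (auto simp: symint_minus)
  qed
qed

section \<open>Uniform limits and power series\<close>

lemma uniform_limit_antiderivative:
  fixes F :: "nat \<Rightarrow> real \<Rightarrow> complex"
  assumes b: "b > 0"
    and F: "\<And>N x. x \<in> {-b..b} \<Longrightarrow> (F N has_vector_derivative F' N x) (at x within {-b..b})"
    and G: "\<And>x. x \<in> {-b..b} \<Longrightarrow> (G has_vector_derivative G' x) (at x within {-b..b})"
    and lim': "uniform_limit {-b..b} F' G' sequentially"
    and lim0: "(\<lambda>N. F N 0) \<longlonglongrightarrow> G 0"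
  shows "uniform_limit {-b..b} F G sequentially"
proof (rule uniform_limitI)
  fix e :: real assume e: "e > 0"
  define d where "d = e / (2 * b)"
  have d: "d > 0" using e b by (simp add: d_def)
  have ev1: "\<forall>\<^sub>F N in sequentially. \<forall>x\<in>{-b..b}. dist (F' N x) (G' x) < d"
    using uniform_limitD[OF lim' d] .
  have ev2: "\<forall>\<^sub>F N in sequentially. dist (F N 0) (G 0) < e / 2"
    by (rule tendstoD[OF lim0]) (use e in simp)
  show "\<forall>\<^sub>F N in sequentially. \<forall>x\<in>{-b..b}. dist (F N x) (G x) < e"
    using ev1 ev2
  proof eventually_elim
    case (elim N)
    show ?case
    proof
      fix x assume x: "x \<in> {-b..b}"
      have "norm ((F N x - G x) - (F N 0 - G 0)) \<le> d * norm (x - 0)"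
      proof (rule differentiable_bound[where S = "{-b..b}" and f = "\<lambda>x. F N x - G x" and f' = "\<lambda>x h. h *\<^sub>R (F' N x - G' x)"])
        fix y assume y: "y \<in> {-b..b}"
        show "((\<lambda>x. F N x - G x) has_derivative (\<lambda>h. h *\<^sub>R (F' N y - G' y))) (at y within {-b..b})"
          using has_vector_derivative_diff[OF F[OF y] G[OF y]] by (simp add: has_vector_derivative_def)
        have "norm (F' N y - G' y) \<le> d" using elim y by (auto simp: dist_norm less_imp_le)
        then show "onorm (\<lambda>h. h *\<^sub>R (F' N y - G' y)) \<le> d"
          by (intro onorm_le) (simp add: mult.commute[of d] mult_left_mono)
      qed (use x b in auto)
      also have "\<dots> \<le> d * b" using x d by (intro mult_left_mono) auto
      also have "\<dots> = e / 2" using b by (simp add: d_def)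
      finally have "norm ((F N x - G x) - (F N 0 - G 0)) \<le> e / 2" .
      moreover have "norm (F N 0 - G 0) < e / 2" using elim by (simp add: dist_norm)
      ultimately show "dist (F N x) (G x) < e"
        unfolding dist_norm
        using norm_triangle_ineq[of "(F N x - G x) - (F N 0 - G 0)" "F N 0 - G 0"] by simp
    qed
  qed
qed

lemma uniform_limit_mult_bounded:
  fixes F :: "nat \<Rightarrow> real \<Rightarrow> complex"
  assumes "uniform_limit {-b..b} F G sequentially" "continuous_on {-b..b} G" "continuous_on {-b..b} g"
  shows "uniform_limit {-b..b} (\<lambda>N x. F N x * g x) (\<lambda>x. G x * g x) sequentially"
  using assms by (intro uniform_lim_mult uniform_limit_const compact_imp_bounded
      compact_continuous_image compact_Icc)

lemma uniform_limit_reflect: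
  assumes "uniform_limit {-b..b} F G sequentially"
  shows "uniform_limit {-b..b} (\<lambda>N x. F N (- x)) (\<lambda>x. G (- x :: real)) sequentially"
  using uniform_limit_compose'[OF assms, of uminus "{-b..b}"] by (auto simp: Pi_iff)

text \<open>
  Convergence at \<open>x = b\<close> gives convergence in the complex disc of radius \<open>b\<close>; there the zeros of a nonzero
  power series are isolated, whereas this one, with its constant term removed, vanishes on a segment
  ending at the origin.
\<close>

lemma powser_const_on_reals:
  fixes a :: "nat \<Rightarrow> complex"
  assumes b: "b > 0"
    and sums: "\<And>x. \<lbrakk>0 \<le> x; x \<le> b\<rbrakk> \<Longrightarrow> (\<lambda>n. a n * of_real x ^ n) sums h"
    and m: "m \<ge> 1"
  shows "a m = 0"
proof (rule ccontr)
  assume am: "a m \<noteq> 0"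
  \<comment> \<open>The constant term is \<open>h\<close>, as \<open>x = 0\<close> shows; without it the series sums to \<open>0\<close>.\<close>
  define c where "c n = (if n = 0 then 0 else a n)" for n
  have a0: "a 0 = h"
    using sums[of 0] powser_sums_zero[of a] b sums_unique2 by fastforce
  have c_sums: "(\<lambda>n. c n * of_real x ^ n) sums 0" if "0 \<le> x" "x \<le> b" for x
  proof -
    have "(\<lambda>n. a n * of_real x ^ n - (if n = 0 then h else 0)) sums (h - h)"
      using sums[OF that] sums_If_finite_set[of "{0::nat}" "\<lambda>_. h"] by (intro sums_diff) auto
    moreover have "a n * of_real x ^ n - (if n = 0 then h else 0) = c n * of_real x ^ n" for n
      by (simp add: c_def a0)
    ultimately show ?thesis by simp
  qed
  have "(\<lambda>n. c n * z ^ n) sums (\<Sum>n. c n * z ^ n)" if "norm z < b" for z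
    using powser_inside[OF sums_summable[OF c_sums[of b]], of z] that b
    by (intro summable_sums) auto
  then obtain s where s: "s > 0" "\<And>z. z \<in> cball 0 s - {0} \<Longrightarrow> (\<Sum>n. c n * z ^ n) \<noteq> 0"
    using powser_0_nonzero[of b 0 c "\<lambda>z. \<Sum>n. c n * z ^ n" m] b am m
    by (auto simp: c_def)
  define x where "x = min s b"
  have "(\<Sum>n. c n * of_real x ^ n) = 0"
    using c_sums[of x] s b by (intro sums_unique[symmetric]) (auto simp: x_def)
  moreover have "complex_of_real x \<in> cball 0 s - {0}" using s b by (auto simp: x_def)
  ultimately show False using s(2) by blast
qed

section \<open>Formal powers and the waves they generate\<close>

text \<open>
  What is used of \<open>\<phi>\<^sub>k\<close> is the second order recursion and the initial values, which are those of \<open>x^k\<close>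
  up to the slope \<open>h\<close> of \<open>\<phi>\<^sub>0\<close>. For \<open>k < 2\<close> the factor \<open>k(k - 1)\<close> vanishes, so the truncated index \<open>k - 2\<close>
  is harmless.
\<close>

locale formal_powers =
  fixes b :: real and q Q :: "real \<Rightarrow> complex" and h :: complex
    and p p' :: "nat \<Rightarrow> real \<Rightarrow> complex"
  assumes b_pos: "b > 0"
    and q_cont: "continuous_on {-b..b} q"
    and Q_deriv: "x \<in> {-b..b} \<Longrightarrow> (Q has_vector_derivative q x) (at x within {-b..b})"
    and Q_0: "Q 0 = 0"
    and p_deriv: "x \<in> {-b..b} \<Longrightarrow> (p k has_vector_derivative p' k x) (at x within {-b..b})"
    and p'_deriv: "x \<in> {-b..b} \<Longrightarrow> (p' k has_vector_derivative
           q x * p k x + of_nat k * of_nat (k - 1) * p (k - 2) x) (at x within {-b..b})"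
    and p_0: "p k 0 = (if k = 0 then 1 else 0)"
    and p'_0: "p' k 0 = (if k = 0 then h else if k = 1 then 1 else 0)"
begin

definition wave :: "(nat \<Rightarrow> complex) \<Rightarrow> (nat \<Rightarrow> complex) \<Rightarrow> nat set \<Rightarrow> real \<Rightarrow> real \<Rightarrow> complex" where
  "wave \<alpha> \<beta> A x t = wsum \<alpha> \<beta> A (\<lambda>i. p i x) (\<lambda>j. of_real t ^ j)"

lemma p_cont: "continuous_on {-b..b} (p k)"
  using p_deriv has_vector_derivative_continuous continuous_on_eq_continuous_within by blast

lemma p'_cont: "continuous_on {-b..b} (p' k)"
  using p'_deriv has_vector_derivative_continuous continuous_on_eq_continuous_within by blast

text \<open>
  The left-hand side is \<open>u\<^sub>x\<^sub>x\<close> and the last sum is \<open>u\<^sub>t\<^sub>t\<close>, both in the form in which termwise differentiation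
  produces them.
\<close>

lemma wave_equation:
  "wsum \<alpha> \<beta> A (\<lambda>i. q x * p i x + of_nat i * of_nat (i - 1) * p (i - 2) x) (\<lambda>j. of_real t ^ j)
   = q x * wave \<alpha> \<beta> A x t
     + wsum \<alpha> \<beta> A (\<lambda>i. p i x) (\<lambda>j. of_nat j * (of_nat (j - 1) * of_real t ^ (j - 2)))"
  using wsum_shift[of \<alpha> \<beta> A "\<lambda>i. p i x" "\<lambda>j. of_real t ^ j"]
  by (simp add: wsum_add wsum_mult wave_def mult.assoc)

section \<open>Stability of the Goursat problem\<close>

text \<open>
  The hypotheses provide derivatives within the closed interval, one-sided at its ends. In the interior they are two-sided
  and can be composed with the change to characteristic coordinates.
\<close>

lemma affine_chain:
  assumes "\<And>x. x \<in> {-b..b} \<Longrightarrow> (g has_vector_derivative g' x) (at x within {-b..b})"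
    and "\<bar>c * s + d\<bar> < b"
  shows "((\<lambda>s. g (c * s + d)) has_vector_derivative of_real c * g' (c * s + d)) (at s)"
proof -
  have x: "c * s + d \<in> {-b<..<b}" using assms(2) by auto
  then have "at (c * s + d) within {-b..b} = at (c * s + d)"
    by (intro at_within_interior) simp
  then have 1: "(g has_vector_derivative g' (c * s + d)) (at (c * s + d))"
    using assms(1)[of "c * s + d"] x by auto
  have 2: "((\<lambda>s. c * s + d) has_vector_derivative c) (at s)"
    by (auto intro!: derivative_eq_intros)
  show ?thesis
    using vector_diff_chain_at[OF 2 1] by (simp add: o_def scaleR_conv_of_real)
qed

text \<open>
  In the characteristic coordinates \<open>s = (t + x)/2\<close>, \<open>r = (t - x)/2\<close> the equation reads \<open>H\<^sub>s\<^sub>r = - q H\<close>, so \<open>H\<close>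
  is determined by its values for \<open>r = 0\<close> and for \<open>s = 0\<close> up to a double integral of \<open>q H\<close>. Weighting
  with \<open>exp(- L (s + r))\<close> gains a factor \<open>1/L^2\<close> from the two integrations; with \<open>L^2 = 2 B + 1\<close> this
  double integral is at most half of the weighted maximum \<open>M\<close> and can be absorbed, which leaves
  \<open>M \<le> 3 \<epsilon> + M/2\<close>.
\<close>

lemma goursat_bound_upper:
  assumes q_le: "\<And>x. x \<in> {-b..b} \<Longrightarrow> norm (q x) \<le> B"
    and right: "\<And>x. x \<in> {-b..b} \<Longrightarrow> norm (wave \<alpha> \<beta> A x x) \<le> \<epsilon>"
    and left: "\<And>x. x \<in> {-b..b} \<Longrightarrow> norm (wave \<alpha> \<beta> A x (- x)) \<le> \<epsilon>"
    and xt: "\<bar>x\<bar> \<le> t" "t \<le> b"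
  shows "norm (wave \<alpha> \<beta> A x t) \<le> 6 * exp (sqrt (2 * B + 1) * b) * \<epsilon>"
proof -
  define L where "L = sqrt (2 * B + 1)"
  have B0: "B \<ge> 0" using order_trans[OF norm_ge_zero q_le[of 0]] b_pos by simp
  have L: "L > 0" and L2: "L * L = 2 * B + 1" using B0 by (auto simp: L_def)
  have eps: "\<epsilon> \<ge> 0" using order_trans[OF norm_ge_zero right[of 0]] b_pos by simp
  define H where "H s r = wave \<alpha> \<beta> A (s - r) (s + r)" for s r
  define Hx where "Hx s r = wsum \<alpha> \<beta> A (\<lambda>i. p' i (s - r)) (\<lambda>j. of_real (s + r) ^ j)
    + wsum \<alpha> \<beta> A (\<lambda>i. p i (s - r)) (\<lambda>j. of_nat j * of_real (s + r) ^ (j - 1))" for s r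
  have pw: "((\<lambda>s. complex_of_real (s + r) ^ j) has_vector_derivative of_nat j * of_real (s + r) ^ (j - 1)) (at s)"
    for s r j
    using power_has_vector_derivative_affine[of 1 r j s] by simp
  have pw': "((\<lambda>r. complex_of_real (s + r) ^ j) has_vector_derivative of_nat j * of_real (s + r) ^ (j - 1)) (at r)"
    for s r j
    using pw[of s j r] by (simp add: add.commute)
  have dH: "((\<lambda>s. H s r) has_vector_derivative Hx s r) (at s)" if "\<bar>s - r\<bar> < b" for s r
  proof -
    have "((\<lambda>s. p i (s - r)) has_vector_derivative p' i (s - r)) (at s)" for i
      using affine_chain[OF p_deriv, of 1 s "-r"] that by simp
    from wsum_has_vector_derivative[OF this pw] show ?thesis
      unfolding H_def wave_def Hx_def .
  qed
  have dHx: "((\<lambda>r. Hx s r) has_vector_derivative - (q (s - r) * H s r)) (at r)" if "\<bar>s - r\<bar> < b" for s r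
  proof -
    have 1: "((\<lambda>r. p i (s - r)) has_vector_derivative - p' i (s - r)) (at r)" for i
      using affine_chain[OF p_deriv, of "-1" r s] that by simp
    have 2: "((\<lambda>r. p' i (s - r)) has_vector_derivative
        - (q (s - r) * p i (s - r) + of_nat i * of_nat (i - 1) * p (i - 2) (s - r))) (at r)" for i
      using affine_chain[OF p'_deriv, of "-1" r s] that by simp
    have 3: "((\<lambda>r. of_nat j * complex_of_real (s + r) ^ (j - 1)) has_vector_derivative
        of_nat j * (of_nat (j - 1) * of_real (s + r) ^ (j - 2))) (at r)" for j
      using has_vector_derivative_mult_right[OF pw'[of s "j - 1" r], of "of_nat j"]
      by (simp add: numeral_2_eq_2)
    show ?thesis unfolding Hx_def
      by (rule has_vector_derivative_eq_rhs,
          rule has_vector_derivative_add[OF wsum_has_vector_derivative[OF 2 pw'] wsum_has_vector_derivative[OF 1 3]])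
        (simp only: wsum_minus wave_equation H_def, simp)
  qed
  \<comment> \<open>The part \<open>\<bar>x\<bar> \<le> t \<le> b\<close> of the plane in the new coordinates.\<close>
  define T where "T = ({0..b} \<times> {0..b}) \<inter> {z. fst z + snd z \<le> b}"
  have T_compact: "compact T"
    unfolding T_def by (intro compact_Int_closed compact_Times compact_Icc closed_Collect_le continuous_intros)
  have contH: "continuous_on X (\<lambda>z. H (fst z) (snd z))"
    if "\<And>z. z \<in> X \<Longrightarrow> \<bar>fst z - snd z\<bar> \<le> b" for X
    unfolding H_def wave_def
    by (intro continuous_on_wsum continuous_intros continuous_on_compose2[OF p_cont])
      (auto dest!: that simp: abs_le_iff)
  have "continuous_on T (\<lambda>z. norm (H (fst z) (snd z)) * exp (- L * (fst z + snd z)))"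
    by (intro continuous_intros contH) (auto simp: T_def)
  moreover have "(0, 0) \<in> T" using b_pos by (auto simp: T_def)
  ultimately obtain z0 where z0: "z0 \<in> T"
    and max0: "\<And>z. z \<in> T \<Longrightarrow> norm (H (fst z) (snd z)) * exp (- L * (fst z + snd z))
        \<le> norm (H (fst z0) (snd z0)) * exp (- L * (fst z0 + snd z0))"
    using continuous_attains_sup[OF T_compact] by blast
  obtain s0 r0 where z0_eq: "z0 = (s0, r0)" by (cases z0)
  define M where "M = norm (H s0 r0) * exp (- L * (s0 + r0))"
  have sr0: "0 \<le> s0" "0 \<le> r0" "s0 + r0 \<le> b" using z0 by (auto simp: T_def z0_eq)
  have HM: "norm (H s r) \<le> M * exp (L * (s + r))" if "0 \<le> s" "0 \<le> r" "s + r \<le> b" for s r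
  proof -
    have "norm (H s r) * exp (- L * (s + r)) \<le> M"
      using max0[of "(s, r)"] that by (simp add: T_def z0_eq M_def)
    then have "norm (H s r) * exp (- L * (s + r)) * exp (L * (s + r)) \<le> M * exp (L * (s + r))"
      by (intro mult_right_mono) auto
    then show ?thesis by (simp add: mult.assoc flip: exp_add)
  qed
  have M0: "M \<ge> 0" by (simp add: M_def)
  \<comment> \<open>The second mixed difference is estimated by integrating \<open>H\<^sub>s\<^sub>r\<close> over \<open>r\<close> and then over \<open>s\<close>.\<close>
  have mixed: "norm ((H s0 r0 - H s0 0) - (H 0 r0 - H 0 0)) \<le> B * M / (L * L) * exp (L * (s0 + r0))"
  proof (cases "s0 = 0 \<or> r0 = 0")
    case True
    then show ?thesis using B0 M0 L by auto
  next
    case False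
    then have pos: "0 < s0" "0 < r0" using sr0 by auto
    have inner: "norm (Hx s r0 - Hx s 0) \<le> B * M / L * exp (L * (s + r0))" if s: "0 < s" "s < s0" for s
    proof -
      have "norm (Hx s r0 - Hx s 0) \<le> B * M / L * exp (L * (s + r0)) - B * M / L * exp (L * (s + 0))"
      proof (rule differentiable_bound_general[OF pos(2)])
        show "continuous_on {0..r0} (Hx s)" unfolding Hx_def
          using s sr0 by (intro continuous_intros continuous_on_wsum continuous_on_compose2[OF p_cont]
              continuous_on_compose2[OF p'_cont]) auto
        show "continuous_on {0..r0} (\<lambda>r. B * M / L * exp (L * (s + r)))"
          by (intro continuous_intros) (use L in auto)
        fix r assume r: "0 < r" "r < r0"
        show "(Hx s has_vector_derivative - (q (s - r) * H s r)) (at r)"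
          using dHx[of s r] s r sr0 by auto
        show "((\<lambda>r. B * M / L * exp (L * (s + r))) has_vector_derivative B * (M * exp (L * (s + r)))) (at r)"
          unfolding has_real_derivative_iff_has_vector_derivative[symmetric]
          using L by (auto intro!: derivative_eq_intros simp: field_simps)
        show "norm (- (q (s - r) * H s r)) \<le> B * (M * exp (L * (s + r)))"
          unfolding norm_minus_cancel norm_mult
          using s r sr0 B0 by (intro mult_mono q_le HM) auto
      qed
      also have "\<dots> \<le> B * M / L * exp (L * (s + r0))" using B0 M0 L by simp
      finally show ?thesis .
    qed
    have "norm ((H s0 r0 - H s0 0) - (H 0 r0 - H 0 0))
        \<le> B * M / (L * L) * exp (L * (s0 + r0)) - B * M / (L * L) * exp (L * (0 + r0))"
    proof (rule differentiable_bound_general[OF pos(1), where f = "\<lambda>s. H s r0 - H s 0"])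
      show "continuous_on {0..s0} (\<lambda>s. H s r0 - H s 0)" unfolding H_def wave_def
        using sr0 by (intro continuous_intros continuous_on_wsum continuous_on_compose2[OF p_cont]) auto
      show "continuous_on {0..s0} (\<lambda>s. B * M / (L * L) * exp (L * (s + r0)))"
        by (intro continuous_intros) (use L in auto)
      fix s assume s: "0 < s" "s < s0"
      show "((\<lambda>s. H s r0 - H s 0) has_vector_derivative Hx s r0 - Hx s 0) (at s)"
        using s sr0 pos by (intro has_vector_derivative_diff dH) auto
      show "((\<lambda>s. B * M / (L * L) * exp (L * (s + r0))) has_vector_derivative B * M / L * exp (L * (s + r0))) (at s)"
        unfolding has_real_derivative_iff_has_vector_derivative[symmetric]
        using L by (auto intro!: derivative_eq_intros simp: field_simps)
      show "norm (Hx s r0 - Hx s 0) \<le> B * M / L * exp (L * (s + r0))" by (rule inner[OF s])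
    qed
    also have "\<dots> \<le> B * M / (L * L) * exp (L * (s0 + r0))" using B0 M0 L by simp
    finally show ?thesis .
  qed
  have edge: "norm (H s0 0) \<le> \<epsilon>" "norm (H 0 r0) \<le> \<epsilon>" "norm (H 0 0) \<le> \<epsilon>"
    using right[of s0] left[of "- r0"] right[of 0] sr0 b_pos by (auto simp: H_def)
  have "norm (H s0 r0) \<le> norm ((H s0 r0 - H s0 0) - (H 0 r0 - H 0 0)) + norm (H s0 0) + norm (H 0 r0) + norm (H 0 0)"
    by norm
  then have "norm (H s0 r0) \<le> B * M / (L * L) * exp (L * (s0 + r0)) + 3 * \<epsilon>"
    using mixed edge by linarith
  moreover have "norm (H s0 r0) = M * exp (L * (s0 + r0))"
    by (simp add: M_def mult.assoc flip: exp_add)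
  moreover have "B * M / (L * L) * exp (L * (s0 + r0)) \<le> M / 2 * exp (L * (s0 + r0))"
  proof (intro mult_right_mono)
    have "B * M * 2 \<le> M * (L * L)" unfolding L2 using B0 M0 by (simp add: algebra_simps)
    then show "B * M / (L * L) \<le> M / 2" using L by (simp add: field_simps)
  qed simp
  ultimately have "M * exp (L * (s0 + r0)) \<le> 6 * \<epsilon>" by linarith
  moreover have "M * 1 \<le> M * exp (L * (s0 + r0))"
    using M0 L sr0 by (intro mult_left_mono) auto
  ultimately have M: "M \<le> 6 * \<epsilon>" by linarith
  have "norm (wave \<alpha> \<beta> A x t) \<le> M * exp (L * t)"
    using HM[of "(t + x) / 2" "(t - x) / 2"] xt by (simp add: H_def field_simps)
  also have "\<dots> \<le> 6 * \<epsilon> * exp (L * b)"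
    using M eps L xt by (intro mult_mono) auto
  finally show ?thesis by (simp add: L_def mult_ac)
qed

lemma wave_reflect: "wave \<alpha> \<beta> A x (- t) = wave \<alpha> (\<lambda>n. - \<beta> n) A x t"
  by (simp add: wave_def wsum_minus_odd)

lemma goursat_bound:
  assumes q_le: "\<And>x. x \<in> {-b..b} \<Longrightarrow> norm (q x) \<le> B"
    and right: "\<And>x. x \<in> {-b..b} \<Longrightarrow> norm (wave \<alpha> \<beta> A x x) \<le> \<epsilon>"
    and left: "\<And>x. x \<in> {-b..b} \<Longrightarrow> norm (wave \<alpha> \<beta> A x (- x)) \<le> \<epsilon>"
    and xt: "\<bar>x\<bar> \<le> \<bar>t\<bar>" "\<bar>t\<bar> \<le> b"
  shows "norm (wave \<alpha> \<beta> A x t) \<le> 6 * exp (sqrt (2 * B + 1) * b) * \<epsilon>"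
proof (cases "t \<ge> 0")
  case True
  then show ?thesis using goursat_bound_upper[OF q_le right left, of x t] xt by simp
next
  case False
  have "norm (wave \<alpha> (\<lambda>n. - \<beta> n) A x (- t)) \<le> 6 * exp (sqrt (2 * B + 1) * b) * \<epsilon>"
    using xt False right left
    by (intro goursat_bound_upper[OF q_le]) (simp_all flip: wave_reflect)
  then show ?thesis using wave_reflect[of \<alpha> \<beta> A x "- t"] by simp
qed

section \<open>Moments of the waves against the formal powers\<close>

text \<open>
  The integrals of \<open>\<phi>\<^sub>i \<phi>\<^sub>k\<close> are all that is needed for the integrals of a wave against \<open>\<phi>\<^sub>k\<close>, as a wave is a
  finite combination of products \<open>\<phi>\<^sub>i(x) t^j\<close>.
\<close>

definition gram :: "nat \<Rightarrow> nat \<Rightarrow> real \<Rightarrow> complex" where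
  "gram i k x = symint b (\<lambda>s. p i s * p k s) x"

lemma gram_0: "gram i k 0 = 0"
  by (simp add: gram_def symint_def)

lemma gram_deriv:
  assumes "x \<in> {-b..b}"
  shows "(gram i k has_vector_derivative p i x * p k x + p i (- x) * p k (- x)) (at x within {-b..b})"
proof -
  have "gram i k = symint b (\<lambda>s. p i s * p k s)" by (simp add: gram_def fun_eq_iff)
  then show ?thesis
    using symint_has_vector_derivative[of b "\<lambda>s. p i s * p k s" x] assms p_cont
    by (simp add: continuous_on_mult)
qed

text \<open>
  Lagrange's identity for the two equations: the derivative of \<open>\<phi>\<^sub>i' \<phi>\<^sub>k - \<phi>\<^sub>i \<phi>\<^sub>k'\<close> does not involve \<open>q\<close>.
  It plays the part of two integrations by parts.
\<close>

lemma gram_lagrange_identity: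
  assumes x: "x \<in> {-b..b}"
  shows "of_nat i * of_nat (i - 1) * gram (i - 2) k x
    = (p' i x * p k x - p i x * p' k x) - (p' i (- x) * p k (- x) - p i (- x) * p' k (- x))
      + of_nat k * of_nat (k - 1) * gram i (k - 2) x"
proof -
  let ?ci = "of_nat i * of_nat (i - 1) :: complex" and ?ck = "of_nat k * of_nat (k - 1) :: complex"
  have e1: "symint b (\<lambda>s. ?ci * (p (i - 2) s * p k s) - ?ck * (p i s * p (k - 2) s)) x
      = (p' i x * p k x - p i x * p' k x) - (p' i (- x) * p k (- x) - p i (- x) * p' k (- x))"
  proof (rule symint_eq[OF _ x])
    fix s assume s: "s \<in> {-b..b}"
    show "((\<lambda>s. p' i s * p k s - p i s * p' k s) has_vector_derivative
        ?ci * (p (i - 2) s * p k s) - ?ck * (p i s * p (k - 2) s)) (at s within {-b..b})"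
      by (rule has_vector_derivative_eq_rhs,
          rule has_vector_derivative_diff[OF has_vector_derivative_mult[OF p'_deriv[OF s] p_deriv[OF s]]
            has_vector_derivative_mult[OF p_deriv[OF s] p'_deriv[OF s]]])
        (simp add: algebra_simps)
  qed
  have e2: "symint b (\<lambda>s. ?ci * (p (i - 2) s * p k s) - ?ck * (p i s * p (k - 2) s)) x
      = ?ci * gram (i - 2) k x - ?ck * gram i (k - 2) x"
    unfolding gram_def symint_mult[symmetric]
    by (intro symint_diff x continuous_intros p_cont)
  show ?thesis
    using trans[OF e2[symmetric] e1] by (simp only: diff_eq_eq)
qed

text \<open>
  The integral of \<open>u(s,x) \<phi>\<^sub>k(s)\<close> over \<open>s\<close> from \<open>-x\<close> to \<open>x\<close>, for the wave \<open>u\<close> with the given coefficients;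
  see \<open>symint_wave\<close>.
\<close>

definition moment where
  "moment \<alpha> \<beta> A k x = wsum \<alpha> \<beta> A (\<lambda>i. gram i k x) (\<lambda>j. of_real x ^ j)"

text \<open>
  The first term is the integral of \<open>u\<^sub>t(s,x) \<phi>\<^sub>k(s)\<close>, which is what differentiation of the moment under the
  integral sign produces. Its derivative contains the derivatives of \<open>u(x,x)\<close> and \<open>u(-x,x)\<close>, over
  which uniform convergence of \<open>u\<close> gives no control. The other two terms are subtracted to remove
  exactly these.
\<close>

definition time_moment where
  "time_moment \<alpha> \<beta> A k x = wsum \<alpha> \<beta> A (\<lambda>i. gram i k x) (\<lambda>j. of_nat j * of_real x ^ (j - 1))
     - wave \<alpha> \<beta> A x x * p k x - wave \<alpha> \<beta> A (- x) x * p k (- x)"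

lemma moment_deriv:
  assumes x: "x \<in> {-b..b}"
  shows "(moment \<alpha> \<beta> A k has_vector_derivative
      2 * (wave \<alpha> \<beta> A x x * p k x) + 2 * (wave \<alpha> \<beta> A (- x) x * p k (- x)) + time_moment \<alpha> \<beta> A k x)
      (at x within {-b..b})"
proof -
  have "((\<lambda>x. wsum \<alpha> \<beta> A (\<lambda>i. gram i k x) (\<lambda>j. of_real x ^ j)) has_vector_derivative
      2 * (wave \<alpha> \<beta> A x x * p k x) + 2 * (wave \<alpha> \<beta> A (- x) x * p k (- x)) + time_moment \<alpha> \<beta> A k x)
      (at x within {-b..b})"
    by (rule has_vector_derivative_eq_rhs, rule wsum_has_vector_derivative[OF gram_deriv[OF x] power_has_vector_derivative])
      (simp add: time_moment_def wsum_add wsum_mult_right wave_def)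
  then show ?thesis unfolding moment_def[abs_def] .
qed

lemma reflect_p_deriv:
  assumes x: "x \<in> {-b..b}"
  shows "((\<lambda>x. p k (- x)) has_vector_derivative - p' k (- x)) (at x within {-b..b})"
  using x by (intro has_vector_derivative_reflect p_deriv) auto

text \<open>
  In the derivative of the first term of \<open>time_moment\<close>, the wave equation trades \<open>u\<^sub>t\<^sub>t\<close> for \<open>u\<^sub>x\<^sub>x - q u\<close> and Lagrange's identity
  moves the operator onto \<open>\<phi>\<^sub>k\<close>. What remains depends on the wave through its values on
  the characteristics and through the moment of index \<open>k - 2\<close>.
\<close>

lemma time_moment_deriv:
  assumes x: "x \<in> {-b..b}"
  shows "(time_moment \<alpha> \<beta> A k has_vector_derivative
      - (2 * (wave \<alpha> \<beta> A x x * p' k x)) + 2 * (wave \<alpha> \<beta> A (- x) x * p' k (- x))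
      + of_nat k * of_nat (k - 1) * moment \<alpha> \<beta> A (k - 2) x)
      (at x within {-b..b})"
proof -
  let ?X = "\<lambda>j. complex_of_real x ^ j" and ?X' = "\<lambda>j. of_nat j * complex_of_real x ^ (j - 1)"
  have X'': "((\<lambda>x. of_nat j * complex_of_real x ^ (j - 1)) has_vector_derivative
      of_nat j * of_nat (j - 1) * of_real x ^ (j - 2)) (at x within {-b..b})" for j
    using has_vector_derivative_mult_right[OF power_has_vector_derivative[of "j - 1" x "{-b..b}"], of "of_nat j"]
    by (simp add: numeral_2_eq_2 mult.assoc)
  have d: "(time_moment \<alpha> \<beta> A k has_vector_derivative
      (wsum \<alpha> \<beta> A (\<lambda>i. p i x * p k x + p i (- x) * p k (- x)) ?X'
        + wsum \<alpha> \<beta> A (\<lambda>i. gram i k x) (\<lambda>j. of_nat j * of_nat (j - 1) * of_real x ^ (j - 2)))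
      - (wave \<alpha> \<beta> A x x * p' k x + (wsum \<alpha> \<beta> A (\<lambda>i. p' i x) ?X + wsum \<alpha> \<beta> A (\<lambda>i. p i x) ?X') * p k x)
      - (wave \<alpha> \<beta> A (- x) x * (- p' k (- x))
         + (wsum \<alpha> \<beta> A (\<lambda>i. - p' i (- x)) ?X + wsum \<alpha> \<beta> A (\<lambda>i. p i (- x)) ?X') * p k (- x)))
      (at x within {-b..b})"
    unfolding time_moment_def[abs_def] wave_def
    by (intro has_vector_derivative_diff has_vector_derivative_mult wsum_has_vector_derivative
        gram_deriv X'' power_has_vector_derivative p_deriv reflect_p_deriv x)
  have "wsum \<alpha> \<beta> A (\<lambda>i. gram i k x) (\<lambda>j. of_nat j * of_nat (j - 1) * of_real x ^ (j - 2))
      = wsum \<alpha> \<beta> A (\<lambda>i. (p' i x * p k x - p i x * p' k x)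
          - (p' i (- x) * p k (- x) - p i (- x) * p' k (- x))
          + of_nat k * of_nat (k - 1) * gram i (k - 2) x) ?X"
    unfolding wsum_shift[symmetric] gram_lagrange_identity[OF x] ..
  also have "\<dots> = (wsum \<alpha> \<beta> A (\<lambda>i. p' i x) ?X * p k x - wave \<alpha> \<beta> A x x * p' k x)
        - (wsum \<alpha> \<beta> A (\<lambda>i. p' i (- x)) ?X * p k (- x) - wave \<alpha> \<beta> A (- x) x * p' k (- x))
        + of_nat k * of_nat (k - 1) * moment \<alpha> \<beta> A (k - 2) x"
    by (simp only: wsum_add wsum_diff wsum_mult wsum_mult_right wave_def moment_def)
  finally have e: "wsum \<alpha> \<beta> A (\<lambda>i. gram i k x) (\<lambda>j. of_nat j * of_nat (j - 1) * of_real x ^ (j - 2)) = \<dots>" .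
  show ?thesis
    by (rule has_vector_derivative_eq_rhs[OF d], unfold e wsum_add wsum_mult_right wsum_minus)
      (simp add: algebra_simps)
qed

lemma continuous_on_wave: "continuous_on {-b..b} (\<lambda>s. wave \<alpha> \<beta> A s t)"
  unfolding wave_def by (intro continuous_on_wsum continuous_intros p_cont)

text \<open>
  The limit functions \<open>\<phi>\<^sub>k(x) - x^k\<close>, together with the function \<open>z\<close> below, satisfy the equations of
  \<open>moment_deriv\<close> and \<open>time_moment_deriv\<close> in which \<open>u(x,x)\<close> and \<open>u(-x,x)\<close> are replaced by their limits. Hence uniform
  convergence of the right-hand sides, known by induction over \<open>k\<close> in steps of two, can be integrated
  twice.
\<close>

lemma moment_limit:
  assumes right: "uniform_limit {-b..b} (\<lambda>N x. wave \<alpha> \<beta> (A N) x x) (\<lambda>x. h / 2 + Q x / 2) sequentially"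
    and left: "uniform_limit {-b..b} (\<lambda>N x. wave \<alpha> \<beta> (A N) x (- x)) (\<lambda>x. h / 2) sequentially"
  shows "uniform_limit {-b..b} (\<lambda>N. moment \<alpha> \<beta> (A N) k) (\<lambda>x. p k x - of_real x ^ k) sequentially"
proof (induction k rule: less_induct)
  case (less k)
  have left': "uniform_limit {-b..b} (\<lambda>N x. wave \<alpha> \<beta> (A N) (- x) x) (\<lambda>x. h / 2) sequentially"
    using uniform_limit_reflect[OF left] by simp
  have Q_cont: "continuous_on {-b..b} Q"
    using Q_deriv has_vector_derivative_continuous continuous_on_eq_continuous_within by blast
  have refl: "continuous_on {-b..b} (\<lambda>x. p k (- x))" "continuous_on {-b..b} (\<lambda>x. p' k (- x))"
    by (intro continuous_on_compose2[OF p_cont] continuous_on_compose2[OF p'_cont] continuous_intros; auto)+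
  \<comment> \<open>The value that \<open>moment_deriv\<close> forces upon the limit of \<open>time_moment\<close> if the moments converge as claimed.\<close>
  define z where "z x = p' k x - of_nat k * of_real x ^ (k - 1) - (h + Q x) * p k x - h * p k (- x)" for x
  have z_deriv: "(z has_vector_derivative
      - (2 * ((h / 2 + Q x / 2) * p' k x)) + 2 * (h / 2 * p' k (- x))
      + of_nat k * of_nat (k - 1) * (p (k - 2) x - of_real x ^ (k - 2))) (at x within {-b..b})"
    if x: "x \<in> {-b..b}" for x
  proof -
    have X'': "((\<lambda>x. of_nat k * complex_of_real x ^ (k - 1)) has_vector_derivative
        of_nat k * of_nat (k - 1) * of_real x ^ (k - 2)) (at x within {-b..b})"
      using has_vector_derivative_mult_right[OF power_has_vector_derivative[of "k - 1" x "{-b..b}"], of "of_nat k"]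
      by (simp add: numeral_2_eq_2 mult.assoc)
    show ?thesis unfolding z_def[abs_def]
      by (rule has_vector_derivative_eq_rhs,
          rule has_vector_derivative_diff[OF has_vector_derivative_diff[OF
            has_vector_derivative_diff[OF p'_deriv[OF x] X'']
            has_vector_derivative_mult[OF has_vector_derivative_add[OF
              has_vector_derivative_const Q_deriv[OF x]] p_deriv[OF x]]]
            has_vector_derivative_mult[OF has_vector_derivative_const reflect_p_deriv[OF x]]])
        (simp add: field_simps)
  qed
  have moment_lim: "uniform_limit {-b..b} (\<lambda>N x. of_nat k * of_nat (k - 1) * moment \<alpha> \<beta> (A N) (k - 2) x)
      (\<lambda>x. of_nat k * of_nat (k - 1) * (p (k - 2) x - of_real x ^ (k - 2))) sequentially"
  proof (cases "k < 2")
    case True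
    then have "of_nat k * of_nat (k - 1) = (0 :: complex)" by auto
    then show ?thesis by (simp only: mult_zero_left uniform_limit_const)
  next
    case False
    then show ?thesis
      by (intro bounded_linear_uniform_limit_intros less) auto
  qed
  have time_moment_lim: "uniform_limit {-b..b} (\<lambda>N. time_moment \<alpha> \<beta> (A N) k) z sequentially"
  proof (rule uniform_limit_antiderivative[OF b_pos time_moment_deriv z_deriv])
    show "uniform_limit {-b..b} (\<lambda>N x. - (2 * (wave \<alpha> \<beta> (A N) x x * p' k x)) + 2 * (wave \<alpha> \<beta> (A N) (- x) x * p' k (- x))
          + of_nat k * of_nat (k - 1) * moment \<alpha> \<beta> (A N) (k - 2) x)
        (\<lambda>x. - (2 * ((h / 2 + Q x / 2) * p' k x)) + 2 * (h / 2 * p' k (- x))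
          + of_nat k * of_nat (k - 1) * (p (k - 2) x - of_real x ^ (k - 2))) sequentially"
      by (intro uniform_limit_add uniform_limit_uminus bounded_linear_uniform_limit_intros moment_lim
          uniform_limit_mult_bounded right left' continuous_intros Q_cont p'_cont refl) auto
    have "(\<lambda>N. wave \<alpha> \<beta> (A N) 0 0) \<longlonglongrightarrow> h / 2"
      using tendsto_uniform_limitI[OF left, of 0] b_pos by simp
    then have "(\<lambda>N. - wave \<alpha> \<beta> (A N) 0 0 * p k 0 - wave \<alpha> \<beta> (A N) 0 0 * p k 0) \<longlonglongrightarrow> - (h / 2) * p k 0 - h / 2 * p k 0"
      by (intro tendsto_intros)
    moreover have "time_moment \<alpha> \<beta> (A N) k 0 = - wave \<alpha> \<beta> (A N) 0 0 * p k 0 - wave \<alpha> \<beta> (A N) 0 0 * p k 0" for N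
      unfolding time_moment_def gram_0 by (simp add: wsum_def)
    moreover have "z 0 = - (h / 2) * p k 0 - h / 2 * p k 0"
      by (cases "k < 2") (auto simp: z_def p_0 p'_0 Q_0 less_2_cases_iff)
    ultimately show "(\<lambda>N. time_moment \<alpha> \<beta> (A N) k 0) \<longlonglongrightarrow> z 0" by presburger
  qed
  show ?case
  proof (rule uniform_limit_antiderivative[OF b_pos moment_deriv])
    fix x assume x: "x \<in> {-b..b}"
    show "((\<lambda>x. p k x - of_real x ^ k) has_vector_derivative
        2 * ((h / 2 + Q x / 2) * p k x) + 2 * (h / 2 * p k (- x)) + z x) (at x within {-b..b})"
      by (rule has_vector_derivative_eq_rhs, rule has_vector_derivative_diff[OF p_deriv[OF x] power_has_vector_derivative])
        (simp add: z_def field_simps)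
  next
    show "uniform_limit {-b..b} (\<lambda>N x. 2 * (wave \<alpha> \<beta> (A N) x x * p k x) + 2 * (wave \<alpha> \<beta> (A N) (- x) x * p k (- x)) + time_moment \<alpha> \<beta> (A N) k x)
        (\<lambda>x. 2 * ((h / 2 + Q x / 2) * p k x) + 2 * (h / 2 * p k (- x)) + z x) sequentially"
      by (intro uniform_limit_add bounded_linear_uniform_limit_intros time_moment_lim
          uniform_limit_mult_bounded right left' continuous_intros Q_cont p_cont refl) auto
    have "moment \<alpha> \<beta> (A N) k 0 = 0" for N
      unfolding moment_def gram_0 by (simp add: wsum_def)
    then show "(\<lambda>N. moment \<alpha> \<beta> (A N) k 0) \<longlonglongrightarrow> p k 0 - of_real 0 ^ k"
      by (simp add: p_0 power_0_left)
  qed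
qed

section \<open>The free wave on the characteristics\<close>

lemma symint_wave:
  assumes x: "x \<in> {-b..b}"
  shows "symint b (\<lambda>s. p i s * wave \<alpha> \<beta> A s x) x = moment \<alpha> \<beta> A i x"
  using symint_wsum[of b "\<lambda>s i. p i s" "p i" x \<alpha> \<beta> A "\<lambda>j. of_real x ^ j", OF p_cont p_cont x]
  by (simp add: moment_def gram_def wave_def mult.commute)

lemma wave_diff:
  assumes "M \<le> N"
  shows "wave \<alpha> \<beta> {..N} x t - wave \<alpha> \<beta> {..M} x t = wave \<alpha> \<beta> {M<..N} x t"
proof -
  have "{M<..N} = {..N} - {..M}" by auto
  then show ?thesis using assms by (simp add: wave_def wsum_def sum_diff)
qed

text \<open>
  With \<open>q = 0\<close> and \<open>h = 0\<close> the formal powers are the ordinary ones.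
\<close>

definition free_wave where
  "free_wave \<alpha> \<beta> N x t = wsum \<alpha> \<beta> {..N::nat} (\<lambda>i. complex_of_real x ^ i) (\<lambda>j. complex_of_real t ^ j)"

text \<open>
  Write \<open>J\<^sub>M(x)\<close> for the integral of \<open>u\<^sub>M(s,-x) u\<^sub>M(s,x)\<close> over \<open>s\<close> from \<open>-x\<close> to \<open>x\<close>, an odd function of \<open>x\<close>.
  If the second factor is \<open>u\<^sub>N\<close> instead and \<open>N\<close> tends to infinity with \<open>M\<close> fixed, then \<open>moment_limit\<close> gives
  the limit \<open>u\<^sub>M(x,-x) - v\<^sub>M(x,-x)\<close>. By \<open>goursat_bound\<close> the replacement of \<open>u\<^sub>N\<close> by \<open>u\<^sub>M\<close> costs arbitrarily
  little, uniformly in \<open>N \<ge> M\<close>, once \<open>M\<close> is large. So \<open>u\<^sub>M(x,-x) - v\<^sub>M(x,-x) - J\<^sub>M(x)\<close> tends to \<open>0\<close>, and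
  \<open>J\<^sub>M\<close> cancels when this is added to the same statement at \<open>-x\<close>.
\<close>

lemma free_wave_antidiagonal_limit:
  assumes right: "uniform_limit {-b..b} (\<lambda>N x. wave \<alpha> \<beta> {..N} x x) (\<lambda>x. h / 2 + Q x / 2) sequentially"
    and left: "uniform_limit {-b..b} (\<lambda>N x. wave \<alpha> \<beta> {..N} x (- x)) (\<lambda>x. h / 2) sequentially"
    and x: "x \<in> {-b..b}"
  shows "(\<lambda>M. free_wave \<alpha> \<beta> M x (- x) + free_wave \<alpha> \<beta> M (- x) x) \<longlonglongrightarrow> h"
proof -
  define U where "U N = wave \<alpha> \<beta> {..N}" for N
  define J where "J M x = symint b (\<lambda>s. U M s (- x) * U M s x) x" for M x
  have J_odd: "J M (- x) = - J M x" for M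
    by (simp add: J_def symint_minus mult.commute)
  have U_cont: "continuous_on {-b..b} (\<lambda>s. U N s t)" for N t
    unfolding U_def by (rule continuous_on_wave)
  obtain B where B: "\<And>x. x \<in> {-b..b} \<Longrightarrow> norm (q x) \<le> B"
    using compact_imp_bounded[OF compact_continuous_image[OF q_cont compact_Icc]]
    unfolding bounded_iff by blast
  define K where "K = 6 * exp (sqrt (2 * B + 1) * b)"
  have K: "K > 0" by (simp add: K_def)
  have Q_cont: "continuous_on {-b..b} Q"
    using Q_deriv has_vector_derivative_continuous continuous_on_eq_continuous_within by blast
  have R_cont: "continuous_on {-b..b} (\<lambda>x. norm (h / 2 + Q x / 2) + norm (h / 2))"
    by (intro continuous_intros Q_cont) auto
  obtain R' where R': "\<And>x. x \<in> {-b..b} \<Longrightarrow> norm (norm (h / 2 + Q x / 2) + norm (h / 2)) \<le> R'"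
    using compact_imp_bounded[OF compact_continuous_image[OF R_cont compact_Icc]]
    unfolding bounded_iff by blast
  have R: "norm (h / 2 + Q x / 2) \<le> R'" "norm (h / 2) \<le> R'" if "x \<in> {-b..b}" for x
    using R'[OF that] norm_ge_zero[of "h / 2 + Q x / 2"] norm_ge_zero[of "h / 2"]
    unfolding real_norm_def by linarith+
  have R0: "R' \<ge> 0" using order_trans[OF norm_ge_zero R(2)[of 0]] b_pos by simp
  have U_bound: "\<forall>\<^sub>F M in sequentially. \<forall>x t. \<bar>x\<bar> \<le> \<bar>t\<bar> \<and> \<bar>t\<bar> \<le> b \<longrightarrow> norm (U M x t) \<le> K * (R' + 1)"
    using uniform_limitD[OF right zero_less_one] uniform_limitD[OF left zero_less_one]
  proof eventually_elim
    case (elim M)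
    have "norm (wave \<alpha> \<beta> {..M} x x) \<le> R' + 1" "norm (wave \<alpha> \<beta> {..M} x (- x)) \<le> R' + 1" if "x \<in> {-b..b}" for x
      using R[OF that] bspec[OF elim(1) that] bspec[OF elim(2) that]
        norm_triangle_sub[of "wave \<alpha> \<beta> {..M} x x" "h / 2 + Q x / 2"] norm_triangle_sub[of "wave \<alpha> \<beta> {..M} x (- x)" "h / 2"]
      by (simp_all add: dist_norm)
    then show ?case unfolding K_def U_def
      by (intro allI impI goursat_bound B) auto
  qed
  \<comment> \<open>The factor \<open>u\<^sub>M(s,-x)\<close> is a finite combination of the \<open>\<phi>\<^sub>i(s)\<close>, which makes the integral one of moments.\<close>
  have cross: "(\<lambda>N. symint b (\<lambda>s. U M s (- x) * U N s x) x) \<longlonglongrightarrow> U M x (- x) - free_wave \<alpha> \<beta> M x (- x)"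
    if x: "x \<in> {-b..b}" for M x
  proof -
    have "symint b (\<lambda>s. U M s (- x) * U N s x) x
        = wsum \<alpha> \<beta> {..M} (\<lambda>i. moment \<alpha> \<beta> {..N} i x) (\<lambda>j. of_real (- x) ^ j)" for N
      using symint_wsum[of b "\<lambda>s i. p i s" "\<lambda>s. U N s x" x \<alpha> \<beta> "{..M}" "\<lambda>j. of_real (- x) ^ j", OF p_cont U_cont x]
      by (simp add: U_def wave_def[of _ _ "{..M}"] symint_wave[OF x])
    moreover have "(\<lambda>N. wsum \<alpha> \<beta> {..M} (\<lambda>i. moment \<alpha> \<beta> {..N} i x) (\<lambda>j. of_real (- x) ^ j))
        \<longlonglongrightarrow> wsum \<alpha> \<beta> {..M} (\<lambda>i. p i x - of_real x ^ i) (\<lambda>j. of_real (- x) ^ j)"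
      by (intro tendsto_wsum tendsto_uniform_limitI[OF moment_limit[OF right left]] x)
    ultimately show ?thesis by (simp add: wsum_diff U_def wave_def free_wave_def)
  qed
  have diff: "(\<lambda>M. U M x (- x) - free_wave \<alpha> \<beta> M x (- x) - J M x) \<longlonglongrightarrow> 0" if x: "x \<in> {-b..b}" for x
  proof (rule tendstoI)
    fix e :: real assume e: "e > 0"
    \<comment> \<open>The error to be estimated is \<open>2 b * (K (R' + 1)) * (K * 2 d)\<close>; this \<open>d\<close> makes it \<open>e/2\<close>.\<close>
  define d where "d = e / (8 * b * K * K * (R' + 1))"
    have d: "d > 0" using e b_pos K R0 by (simp add: d_def)
    have close: "\<forall>\<^sub>F M in sequentially. (\<forall>x\<in>{-b..b}. norm (U M x x - (h / 2 + Q x / 2)) < d)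
        \<and> (\<forall>x\<in>{-b..b}. norm (U M x (- x) - h / 2) < d)"
      using uniform_limitD[OF right d] uniform_limitD[OF left d] unfolding U_def dist_norm
      by (rule eventually_conj)
    then obtain M0 where M0: "\<And>M x. M \<ge> M0 \<Longrightarrow> x \<in> {-b..b} \<Longrightarrow> norm (U M x x - (h / 2 + Q x / 2)) < d"
        "\<And>M x. M \<ge> M0 \<Longrightarrow> x \<in> {-b..b} \<Longrightarrow> norm (U M x (- x) - h / 2) < d"
      unfolding eventually_sequentially by blast
    show "\<forall>\<^sub>F M in sequentially. dist (U M x (- x) - free_wave \<alpha> \<beta> M x (- x) - J M x) 0 < e"
      using U_bound eventually_ge_at_top[of M0]
    proof eventually_elim
      case (elim M)
      have "norm (symint b (\<lambda>s. U M s (- x) * U N s x) x - J M x) \<le> e / 2" if N: "N \<ge> M" for N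
      proof -
        have UU: "U N y t - U M y t = wave \<alpha> \<beta> {M<..N} y t" for y t
          unfolding U_def by (rule wave_diff[OF N])
        have "norm (wave \<alpha> \<beta> {M<..N} y y) \<le> 2 * d" "norm (wave \<alpha> \<beta> {M<..N} y (- y)) \<le> 2 * d" if "y \<in> {-b..b}" for y
          using M0[OF elim(2) that] M0[OF order_trans[OF elim(2) N] that]
            norm_triangle_ineq4[of "U N y y - (h / 2 + Q y / 2)" "U M y y - (h / 2 + Q y / 2)"]
            norm_triangle_ineq4[of "U N y (- y) - h / 2" "U M y (- y) - h / 2"]
          by (auto simp flip: UU)
        then have small: "norm (U N y t - U M y t) \<le> K * (2 * d)" if "\<bar>y\<bar> \<le> \<bar>t\<bar>" "\<bar>t\<bar> \<le> b" for y t
          unfolding UU K_def using that by (intro goursat_bound B) auto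
        have "symint b (\<lambda>s. U M s (- x) * U N s x) x - J M x
            = symint b (\<lambda>s. U M s (- x) * (U N s x - U M s x)) x"
          unfolding J_def right_diff_distrib
          by (rule symint_diff[symmetric]) (intro continuous_intros U_cont x)+
        also have "norm \<dots> \<le> 2 * b * ((K * (R' + 1)) * (K * (2 * d)))"
        proof (rule norm_symint_le[OF _ x])
          show "continuous_on {-b..b} (\<lambda>s. U M s (- x) * (U N s x - U M s x))"
            by (intro continuous_intros U_cont)
          fix s assume s: "\<bar>s\<bar> \<le> \<bar>x\<bar>"
          then show "norm (U M s (- x) * (U N s x - U M s x)) \<le> (K * (R' + 1)) * (K * (2 * d))"
            unfolding norm_mult using x K R0 elim(1)
            by (intro mult_mono small) auto
        qed
        also have "\<dots> = d * (8 * b * K * K * (R' + 1)) / 2" by (simp add: field_simps)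
        also have "\<dots> = e / 2" using b_pos K R0 by (simp add: d_def)
        finally show ?thesis .
      qed
      then have "norm (U M x (- x) - free_wave \<alpha> \<beta> M x (- x) - J M x) \<le> e / 2"
        by (intro Lim_norm_ubound[OF _ tendsto_diff[OF cross[OF x] tendsto_const]]
            eventually_sequentiallyI[of M]) auto
      then show ?case using e by simp
    qed
  qed
  have x': "- x \<in> {-b..b}" using x by auto
  have "(\<lambda>M. (U M x (- x) + U M (- x) (- (- x)))
        - ((U M x (- x) - free_wave \<alpha> \<beta> M x (- x) - J M x)
           + (U M (- x) (- (- x)) - free_wave \<alpha> \<beta> M (- x) (- (- x)) - J M (- x)))) \<longlonglongrightarrow> (h / 2 + h / 2) - (0 + 0)"
    by (intro tendsto_diff tendsto_add diff[OF x] diff[OF x']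
        tendsto_uniform_limitI[OF left x, folded U_def] tendsto_uniform_limitI[OF left x', folded U_def])
  then show ?thesis by (simp add: J_odd add.commute)
qed

theorem even_coefficients_agree:
  assumes right: "uniform_limit {-b..b} (\<lambda>N x. wave \<alpha> \<beta> {..N} x x) (\<lambda>x. h / 2 + Q x / 2) sequentially"
    and left: "uniform_limit {-b..b} (\<lambda>N x. wave \<alpha> \<beta> {..N} x (- x)) (\<lambda>x. h / 2) sequentially"
    and n: "n \<ge> 1"
  shows "\<alpha> (2 * n) = \<beta> (2 * n)"
proof -
  define w where "w n = (\<Sum>j\<le>n. of_nat (n choose j) * (if even j then \<alpha> n else \<beta> n) * (- 1) ^ j)" for n
  have diag: "free_wave \<alpha> \<beta> N x (- x) = (\<Sum>n\<le>N. w n * of_real x ^ n)" for N x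
    using wsum_power_diag[of \<alpha> \<beta> "{..N}" "of_real x"] by (simp add: free_wave_def w_def)
  have "(\<lambda>n. w n * (1 + (- 1) ^ n) * of_real x ^ n) sums h" if "0 \<le> x" "x \<le> b" for x
  proof -
    have "free_wave \<alpha> \<beta> N x (- x) + free_wave \<alpha> \<beta> N (- x) x = (\<Sum>n\<le>N. w n * (1 + (- 1) ^ n) * of_real x ^ n)" for N
      using diag[of N x] diag[of N "- x"]
      by (simp add: power_minus[of "complex_of_real x"] algebra_simps flip: sum.distrib)
    then show ?thesis
      unfolding sums_def_le using free_wave_antidiagonal_limit[OF right left, of x] that by simp
  qed
  from powser_const_on_reals[OF b_pos this, of "2 * n"] n have "w (2 * n) = 0" by simp
  then show ?thesis
    using alternating_binomial_coeff[of "2 * n" "\<alpha> (2 * n)" "\<beta> (2 * n)"] n by (simp add: w_def)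
qed

end

section \<open>The functions phi as formal powers\<close>

lemma primitive_from_0:
  fixes g :: "real \<Rightarrow> complex"
  assumes "b > 0" "continuous_on {-b..b} g" "x \<in> {-b..b}"
  shows "((\<lambda>x. LBINT s=0..x. g s) has_vector_derivative g x) (at x within {-b..b})"
  using interval_integral_FTC2[of "-b" 0 b g x] assms by (simp add: zero_ereal_def)

text \<open>
  For fixed \<open>k\<close> this is the chain of iterated integrals that ends in the factor \<open>\<phi>\<^sub>k / f\<close> at index \<open>k\<close>. The parity of
  \<open>k\<close> selects the family so that the last two weights are always \<open>1/f^2\<close> (at index \<open>k\<close>) and \<open>f^2\<close>
  (at index \<open>k - 1\<close>).
\<close>

definition rec_int :: "(real \<Rightarrow> complex) \<Rightarrow> nat \<Rightarrow> nat \<Rightarrow> real \<Rightarrow> complex" where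
  "rec_int f k = (if odd k then recX f else recXt f)"

lemma phi_rec_int: "phi f k x = f x * rec_int f k k x"
  by (simp add: phi_def rec_int_def)

lemma rec_int_0: "rec_int f k 0 x = 1"
  by (simp add: rec_int_def)

lemma rec_int_at_0: "rec_int f k (Suc j) 0 = 0"
  by (simp add: rec_int_def interval_integral_endpoints_same zero_ereal_def)

lemma powi_minus_one: "(z::complex) powi (- 1) = inverse z"
  by (simp add: power_int_minus)

lemma rec_int_has_vector_derivative:
  fixes f :: "real \<Rightarrow> complex"
  assumes "b > 0" and f: "continuous_on {-b..b} f" "\<And>x. x \<in> {-b..b} \<Longrightarrow> f x \<noteq> 0"
    and x: "x \<in> {-b..b}"
  shows "(rec_int f k (Suc j) has_vector_derivative
      of_nat (Suc j) * (rec_int f k j x * (f x ^ 2) powi ((- 1) ^ (if odd k then Suc j else j))))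
      (at x within {-b..b})"
proof -
  have w: "continuous_on {-b..b} (\<lambda>x. (f x ^ 2) powi ((- 1) ^ i))" for i :: nat
  proof (cases "even i")
    case True
    then show ?thesis using f by (auto intro!: continuous_intros)
  next
    case False
    then show ?thesis using f by (auto simp: powi_minus_one intro!: continuous_intros)
  qed
  have unfold: "rec_int f k (Suc j) = (\<lambda>x. of_nat (Suc j) *
      (LBINT s=0..x. rec_int f k j s * (f s ^ 2) powi ((- 1) ^ (if odd k then Suc j else j))))" for j
    by (simp add: rec_int_def fun_eq_iff)
  have cont: "continuous_on {-b..b} (rec_int f k j)" for j
  proof (induction j)
    case 0
    then show ?case by (simp add: rec_int_0[abs_def] continuous_on_const cong: continuous_on_cong)
  next
    case (Suc j)
    have "continuous_on {-b..b} (\<lambda>x. LBINT s=0..x. rec_int f k j s * (f s ^ 2) powi ((- 1) ^ (if odd k then Suc j else j)))"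
      using primitive_from_0[OF assms(1) continuous_on_mult[OF Suc w]]
        has_vector_derivative_continuous continuous_on_eq_continuous_within by blast
    then show ?case unfolding unfold by (intro continuous_intros)
  qed
  show ?thesis unfolding unfold[of j]
    by (intro has_vector_derivative_mult_right primitive_from_0 assms(1) continuous_on_mult cont w x)
qed

text \<open>
  The derivative of \<open>\<phi>\<^sub>k\<close>. The last weight \<open>1/f^2\<close> combines with the factor \<open>f\<close> of \<open>\<phi>\<^sub>k\<close> to \<open>1/f\<close>.
\<close>

definition phi' :: "(real \<Rightarrow> complex) \<Rightarrow> (real \<Rightarrow> complex) \<Rightarrow> nat \<Rightarrow> real \<Rightarrow> complex" where
  "phi' f f' k x = f' x * rec_int f k k x + of_nat k * rec_int f k (k - 1) x / f x"

text \<open>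
  Two differentiations of \<open>\<phi>\<^sub>k\<close> remove two layers of the chain of integrals. The terms
  that contain \<open>f'\<close> and the integral of index \<open>k - 1\<close> cancel, and what is left of the chain belongs to
  \<open>\<phi>\<^sub>k\<^sub>-\<^sub>2\<close>, since \<open>k\<close> and \<open>k - 2\<close> have the same parity.
\<close>

lemma phi_formal_powers:
  assumes b: "b > 0" and q: "continuous_on {-b..b} q"
    and f: "\<And>x. x \<in> {-b..b} \<Longrightarrow> (f has_vector_derivative f' x) (at x within {-b..b})"
    and f': "\<And>x. x \<in> {-b..b} \<Longrightarrow> (f' has_vector_derivative q x * f x) (at x within {-b..b})"
    and nz: "\<And>x. x \<in> {-b..b} \<Longrightarrow> f x \<noteq> 0"
    and f0: "f 0 = 1"
  shows "formal_powers b q (\<lambda>x. LBINT s=0..x. q s) (f' 0) (phi f) (phi' f f')"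
proof
  have f_cont: "continuous_on {-b..b} f"
    using f has_vector_derivative_continuous continuous_on_eq_continuous_within by blast
  note deriv = rec_int_has_vector_derivative[OF b f_cont nz]
  have top: "(rec_int f k k has_vector_derivative of_nat k * rec_int f k (k - 1) x / f x ^ 2)
      (at x within {-b..b})" if x: "x \<in> {-b..b}" for k x
  proof (cases k)
    case 0
    then show ?thesis by (simp add: rec_int_0[abs_def])
  next
    case (Suc j)
    have "(f x ^ 2) powi ((- 1) ^ (if odd k then Suc j else j)) = inverse (f x ^ 2)"
      using Suc by (auto simp: powi_minus_one)
    then show ?thesis using deriv[OF _ x, of k j] Suc by (simp add: divide_inverse mult.assoc)
  qed
  have below: "(rec_int f k (k - 1) has_vector_derivative of_nat (k - 1) * rec_int f (k - 2) (k - 2) x * f x ^ 2)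
      (at x within {-b..b})" if x: "x \<in> {-b..b}" for k x
  proof (cases "k < 2")
    case True
    then have "k - 1 = 0" by simp
    then show ?thesis by (simp add: rec_int_0[abs_def])
  next
    case False
    then obtain j where j: "k = Suc (Suc j)" by (metis add_2_eq_Suc le_Suc_ex not_less)
    have "(f x ^ 2) powi ((- 1) ^ (if odd k then Suc j else j)) = f x ^ 2"
      using j by auto
    moreover have "rec_int f j j = rec_int f k j" using j by (simp add: rec_int_def)
    ultimately show ?thesis using deriv[OF _ x, of k j] j by (simp add: mult.assoc)
  qed
  have inv_f: "((\<lambda>x. inverse (f x)) has_vector_derivative - f' x / f x ^ 2) (at x within {-b..b})"
    if x: "x \<in> {-b..b}" for x
  proof -
    have "(f has_derivative (\<lambda>h. h *\<^sub>R f' x)) (at x within {-b..b})"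
      using f[OF x] by (simp add: has_vector_derivative_def)
    from Deriv.has_derivative_inverse[OF nz[OF x] this] show ?thesis
      by (simp add: has_vector_derivative_def power2_eq_square divide_inverse algebra_simps)
  qed
  show "b > 0" "continuous_on {-b..b} q" by (fact b q)+
  show "(LBINT s=0..ereal 0. q s) = 0" by (simp add: zero_ereal_def)
  fix x k
  {
    assume x: "x \<in> {-b..b}"
    show "((\<lambda>x. LBINT s=0..x. q s) has_vector_derivative q x) (at x within {-b..b})"
      by (rule primitive_from_0[OF b q x])
    show "(phi f k has_vector_derivative phi' f f' k x) (at x within {-b..b})"
      unfolding phi_rec_int[abs_def]
      by (rule has_vector_derivative_eq_rhs[OF has_vector_derivative_mult[OF f[OF x] top[OF x]]])
        (use nz[OF x] in \<open>simp add: phi'_def power2_eq_square\<close>)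
    show "(phi' f f' k has_vector_derivative
        q x * phi f k x + of_nat k * of_nat (k - 1) * phi f (k - 2) x) (at x within {-b..b})"
      unfolding phi'_def[abs_def] divide_inverse
      by (rule has_vector_derivative_eq_rhs[OF has_vector_derivative_add[OF
            has_vector_derivative_mult[OF f'[OF x] top[OF x]]
            has_vector_derivative_mult[OF has_vector_derivative_mult[OF
              has_vector_derivative_const below[OF x]] inv_f[OF x]]]])
        (use nz[OF x] in \<open>simp add: phi_rec_int power2_eq_square field_simps\<close>)
  }
  show "phi f k 0 = (if k = 0 then 1 else 0)"
    using f0 by (cases k) (simp_all add: phi_rec_int rec_int_0 rec_int_at_0)
  show "phi' f f' k 0 = (if k = 0 then f' 0 else if k = 1 then 1 else 0)"
    using f0 by (cases k rule: nat.exhaust[case_product nat.exhaust]; cases "k - 1")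
      (auto simp: phi'_def rec_int_0 rec_int_at_0)
qed

section \<open>Coefficients of even index\<close>

lemma wsum_phi:
  "wsum \<alpha> \<beta> {..N} (\<lambda>i. phi f i x) (\<lambda>j. of_real x ^ j)
   = (\<Sum>n=0..N. \<alpha> n * cfun f n x) + (\<Sum>n=1..N. \<beta> n * sfun f n x)"
proof -
  have "(\<Sum>j\<le>n. of_nat (n choose j) * (if even j then \<alpha> n else \<beta> n) * phi f (n - j) x * of_real x ^ j)
      = \<alpha> n * cfun f n x + \<beta> n * sfun f n x" for n
  proof -
    have sets: "{k. k \<le> n \<and> even k} = {k\<in>{..n}. even k}" "{k. k \<le> n \<and> odd k} = {k\<in>{..n}. odd k}"
      by auto
    show ?thesis
      unfolding cfun_def sfun_def sets sum_distrib_left sum.inter_filter[OF finite_atMost]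
        sum.distrib[symmetric]
      by (intro sum.cong) auto
  qed
  moreover have "(\<Sum>n\<le>N. \<beta> n * sfun f n x) = (\<Sum>n=1..N. \<beta> n * sfun f n x)"
    unfolding atMost_atLeast0 by (subst sum.atLeast_Suc_atMost) (simp_all add: sfun_0)
  ultimately show ?thesis
    by (simp add: wsum_def sum.distrib atMost_atLeast0)
qed

theorem proposition5p3:
  fixes b :: real
    and q f f' :: "real \<Rightarrow> complex"
    and h :: complex
    and \<alpha> \<beta> :: "nat \<Rightarrow> complex"
  assumes "b > 0"
    and "continuous_on {-b..b} q"
    and "\<And>x. x \<in> {-b..b} \<Longrightarrow> (f has_vector_derivative f' x) (at x within {-b..b})"
    and "\<And>x. x \<in> {-b..b} \<Longrightarrow> (f' has_vector_derivative q x * f x) (at x within {-b..b})"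
    and "\<And>x. x \<in> {-b..b} \<Longrightarrow> f x \<noteq> 0"
    and "f 0 = 1"
    and "h = f' 0"
    and "uniform_limit {-b..b} (\<lambda>N x. \<Sum>n=0..N. \<alpha> n * cfun f n x)
           (\<lambda>x. h / 2 + 1 / 4 * (LBINT s=0..x. q s)) sequentially"
    and "uniform_limit {-b..b} (\<lambda>N x. \<Sum>n=1..N. \<beta> n * sfun f n x)
           (\<lambda>x. 1 / 4 * (LBINT s=0..x. q s)) sequentially"
  shows "\<forall>n\<ge>1. \<alpha> (2 * n) = \<beta> (2 * n)"
proof (intro allI impI)
  fix n :: nat assume n: "n \<ge> 1"
  interpret formal_powers b q "\<lambda>x. LBINT s=0..x. q s" h "phi f" "phi' f f'"
    using phi_formal_powers[OF assms(1-6)] assms(7) by simp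
  have right: "wave \<alpha> \<beta> {..N} x x = (\<Sum>n=0..N. \<alpha> n * cfun f n x) + (\<Sum>n=1..N. \<beta> n * sfun f n x)" for N x
    unfolding wave_def by (rule wsum_phi)
  have left: "wave \<alpha> \<beta> {..N} x (- x) = (\<Sum>n=0..N. \<alpha> n * cfun f n x) - (\<Sum>n=1..N. \<beta> n * sfun f n x)" for N x
    unfolding wave_reflect unfolding wave_def wsum_phi by (simp add: sum_negf)
  show "\<alpha> (2 * n) = \<beta> (2 * n)"
  proof (rule even_coefficients_agree[OF _ _ n])
    show "uniform_limit {-b..b} (\<lambda>N x. wave \<alpha> \<beta> {..N} x x) (\<lambda>x. h / 2 + (LBINT s=0..x. q s) / 2) sequentially"
      using uniform_limit_add[OF assms(8,9)] by (simp add: right add.commute)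
    show "uniform_limit {-b..b} (\<lambda>N x. wave \<alpha> \<beta> {..N} x (- x)) (\<lambda>x. h / 2) sequentially"
      using uniform_limit_minus[OF assms(8,9)] by (simp add: left)
  qed
qed

end
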